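(* Let $y$ be a real number and $\psi:\mathbb{Z}_{\ge1}\to[0,\infty)$. For an integer $m\geq1$, let $\mathcal{E}^{my}$ be the set of real $x$ for which there are infinitely many pairs of integers $(a,n)$ with $n\geq1$, $\gcd(a,n)=1$, and $|nx-a+my|<\psi(n)$. Let $\mathcal{E}=\bigcup_{m\geq1}\mathcal{E}^{my}$ (the set of $x$ for which there exists such an $m$) and $\bar{\mathcal{E}}=\limsup_{m\to\infty}\mathcal{E}^{my}$ (the set of $x$ lying in $\mathcal{E}^{my}$ for infinitely many $m\geq1$). Then each of $\mathcal{E}$ and $\bar{\mathcal{E}}$ is either Lebesgue-null or has Lebesgue-null complement in $\mathbb{R}$. *)

theory Defs
  imports "HOL-Analysis.Analysis"
begin

definition approx_set :: "(nat \<Rightarrow> real) \<Rightarrow> real \<Rightarrow> real set" where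
  "approx_set \<psi> z = {x. infinite {(a :: int, n :: nat). n \<ge> 1 \<and> gcd a (int n) = 1 \<and>
     \<bar>real n * x - of_int a + z\<bar> < \<psi> n}}"

definition approx_union :: "(nat \<Rightarrow> real) \<Rightarrow> real \<Rightarrow> real set" where
  "approx_union \<psi> y = (\<Union>m\<in>{1..}. approx_set \<psi> (real m * y))"

text \<open>The limit superior in the complete lattice of sets; the term with index 0 does not
  affect it.\<close>

definition approx_limsup :: "(nat \<Rightarrow> real) \<Rightarrow> real \<Rightarrow> real set" where
  "approx_limsup \<psi> y = limsup (\<lambda>m. approx_set \<psi> (real m * y))"

lemma approx_limsup_iff:
  "x \<in> approx_limsup \<psi> y \<longleftrightarrow> infinite {m. m \<ge> 1 \<and> x \<in> approx_set \<psi> (real m * y)}"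
proof -
  have "x \<in> approx_limsup \<psi> y \<longleftrightarrow> (\<forall>k. \<exists>m\<ge>k. x \<in> approx_set \<psi> (real m * y))"
    by (auto simp: approx_limsup_def limsup_INF_SUP)
  also have "\<dots> \<longleftrightarrow> (\<forall>k. \<exists>m\<ge>k. m \<ge> 1 \<and> x \<in> approx_set \<psi> (real m * y))"
    by (meson le_trans nat_le_linear)
  also have "\<dots> \<longleftrightarrow> infinite {m. m \<ge> 1 \<and> x \<in> approx_set \<psi> (real m * y)}"
    by (simp add: infinite_nat_iff_unbounded_le)
  finally show ?thesis .
qed

end

theory Submission
  imports Defs
begin

text \<open>
  If \<open>\<psi> n / n\<close> does not tend to 0, a sieve bound on the gaps between integers coprime to \<open>n\<close> makes
  every approximation set equal to the real line. Otherwise a Vitali covering argument (Cassels)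
  shows that multiplying \<open>\<psi>\<close> by a constant changes the approximation sets only by null sets.

  Following Gallagher, fix a prime \<open>p\<close> and split the denominators \<open>n\<close> according to whether \<open>p\<close> divides
  \<open>n\<close> not at all, exactly once, or at least twice. Up to scaling \<open>\<psi>\<close> by \<open>p\<close>, the maps \<open>x \<mapsto> p x\<close> and
  \<open>x \<mapsto> p x + 1 / p\<close> send the first two parts with shift \<open>m y\<close> into the same parts with shift
  \<open>p m y\<close>, so after combining over all \<open>m\<close> these parts are invariant under an ergodic map and hence
  null or conull. The third part is \<open>1 / p\<close>-periodic. So either some prime yields a conull part, or the
  whole set is almost everywhere \<open>1 / p\<close>-periodic for every prime \<open>p\<close>, and is therefore null or conull.
\<close>

subsection \<open>Scaling the radii of a limsup set\<close>

text \<open>Choose an open \<open>U\<close> containing \<open>S\<close> whose excess has measure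
  less than \<open>e\<close>. Vitali's theorem covers almost all of \<open>S\<close> by disjoint
  balls from the hypothesis that lie in \<open>U\<close>. Summing over them bounds the measure of
  \<open>S\<close> by \<open>\<theta>\<close> times that of \<open>U\<close>; then \<open>e\<close>
  tends to 0. The balls have to contain \<open>x\<close> but need not be centred at it.\<close>

lemma null_if_upper_density_lt_1:
  fixes S :: "real set" and \<theta> :: real
  assumes S: "S \<in> sets borel" "emeasure lborel S < \<infinity>" and \<theta>: "0 \<le> \<theta>" "\<theta> < 1"
    and dens: "\<And>x d. x \<in> S \<Longrightarrow> 0 < d \<Longrightarrow> \<exists>c \<rho>. x \<in> ball c \<rho> \<and> \<rho> < d \<and>
        emeasure lborel (S \<inter> ball c \<rho>) \<le> ennreal \<theta> * emeasure lborel (ball c \<rho>)"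
  shows "emeasure lborel S = 0"
proof -
  let ?\<mu> = "emeasure (lborel :: real measure)"
  have "?\<mu> S \<le> ennreal \<theta> * (?\<mu> S + ennreal e)" if "e > 0" for e
  proof -
    have "S \<in> sets lebesgue" using S by simp
    then obtain U where U: "open U" "S \<subseteq> U" "U - S \<in> lmeasurable"
      "emeasure lebesgue (U - S) < ennreal e"
      using sets_lebesgue_outer_open[of S e] \<open>e > 0\<close> by blast
    define K where "K = {(c, \<rho>). ball c \<rho> \<subseteq> U \<and> ?\<mu> (S \<inter> ball c \<rho>) \<le> ennreal \<theta> * ?\<mu> (ball c \<rho>)}"
    have "\<exists>i. i \<in> K \<and> x \<in> ball (fst i) (snd i) \<and> snd i < d" if "x \<in> S" "d > 0" for x d
    proof -
      obtain e' where e': "e' > 0" "ball x e' \<subseteq> U"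
        using U \<open>x \<in> S\<close> by (meson open_contains_ball subsetD)
      obtain c \<rho> where c: "x \<in> ball c \<rho>" "\<rho> < min d (e'/2)"
        "?\<mu> (S \<inter> ball c \<rho>) \<le> ennreal \<theta> * ?\<mu> (ball c \<rho>)"
        using dens[OF \<open>x \<in> S\<close>, of "min d (e'/2)"] \<open>d > 0\<close> e' by auto
      have "ball c \<rho> \<subseteq> ball x e'"
        using c(1,2) by (auto simp: dist_real_def)
      then have "(c, \<rho>) \<in> K" using c(3) e'(2) by (auto simp: K_def)
      then show ?thesis using c(1,2) by (intro exI[of _ "(c, \<rho>)"]) auto
    qed
    then obtain C where C: "countable C" "C \<subseteq> K"
       "pairwise (\<lambda>i j. disjnt (ball (fst i) (snd i)) (ball (fst j) (snd j))) C"
       "negligible (S - (\<Union>i \<in> C. ball (fst i) (snd i)))"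
      by (rule Vitali_covering_theorem_balls)
    let ?B = "\<lambda>i::real \<times> real. ball (fst i) (snd i)"
    have disj: "disjoint_family_on ?B C" "disjoint_family_on (\<lambda>i. S \<inter> ?B i) C"
      using C(3) unfolding disjoint_family_on_def pairwise_def disjnt_def by blast+
    have opn: "open (\<Union>i\<in>C. ?B i)" by auto
    have "emeasure lebesgue (S - (\<Union>i\<in>C. ?B i)) = 0"
      using C(4) by (simp add: negligible_iff_null_sets null_sets_def)
    then have 0: "?\<mu> (S - (\<Union>i\<in>C. ?B i)) = 0"
      using S(1) opn by simp
    have "?\<mu> S \<le> ?\<mu> ((S - (\<Union>i\<in>C. ?B i)) \<union> (\<Union>i\<in>C. S \<inter> ?B i))"
      using S opn C(1) by (intro emeasure_mono) (auto intro!: sets.countable_UN')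
    also have "\<dots> \<le> ?\<mu> (S - (\<Union>i\<in>C. ?B i)) + ?\<mu> (\<Union>i\<in>C. S \<inter> ?B i)"
      using S opn C(1) by (intro emeasure_subadditive) (auto intro!: sets.countable_UN')
    also have "\<dots> = ?\<mu> (\<Union>i\<in>C. S \<inter> ?B i)" using 0 by simp
    also have "\<dots> = (\<integral>\<^sup>+i. ?\<mu> (S \<inter> ?B i) \<partial>count_space C)"
      using S C(1) disj by (intro emeasure_UN_countable) auto
    also have "\<dots> \<le> (\<integral>\<^sup>+i. ennreal \<theta> * ?\<mu> (?B i) \<partial>count_space C)"
      using C(2) by (intro nn_integral_mono) (auto simp: K_def)
    also have "\<dots> = ennreal \<theta> * (\<integral>\<^sup>+i. ?\<mu> (?B i) \<partial>count_space C)"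
      by (intro nn_integral_cmult) auto
    also have "(\<integral>\<^sup>+i. ?\<mu> (?B i) \<partial>count_space C) = ?\<mu> (\<Union>i\<in>C. ?B i)"
      using C(1) disj by (intro emeasure_UN_countable[symmetric]) auto
    also have "\<dots> \<le> ?\<mu> (S \<union> (U - S))"
      using C(2) S U(1) by (intro emeasure_mono) (fastforce simp: K_def)+
    also have "\<dots> \<le> ?\<mu> S + ?\<mu> (U - S)"
      using S U(1) by (intro emeasure_subadditive) auto
    also have "?\<mu> (U - S) \<le> ennreal e"
      using U(1,4) S by simp
    finally show ?thesis by (simp add: mult_left_mono add_left_mono)
  qed
  \<comment> \<open>Finite measure permits passing to reals, where \<open>\<theta> * s\<close> can
    be subtracted.\<close>
  moreover obtain s where s: "?\<mu> S = ennreal s" "s \<ge> 0"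
    using S(2) by (cases "?\<mu> S") auto
  ultimately have "s \<le> \<theta> * (s + e)" if "e > 0" for e
    using that \<theta>
      by (metis add_nonneg_nonneg ennreal_le_iff ennreal_mult' ennreal_plus less_imp_le mult_nonneg_nonneg)
  then have *: "s * (1 - \<theta>) \<le> \<theta> * e" if "e > 0" for e
    using that by (force simp: algebra_simps)
  have "s * (1 - \<theta>) \<le> 0"
  proof (rule field_le_epsilon)
    fix e :: real assume "e > 0"
    then have "\<theta> * e \<le> e" using \<theta> by (simp add: mult_left_le_one_le)
    then show "s * (1 - \<theta>) \<le> 0 + e" using *[OF \<open>e > 0\<close>] by simp
  qed
  then have "s \<le> 0" using \<theta> by (simp add: mult_le_0_iff)
  then show ?thesis using s by simp
qed

text \<open>Counts indices \<open>n\<close> and not pairs of an index and a centre. The two agree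
  when only finitely many centres of each index lie near a given point, as for the fractions
  below.\<close>

definition limsup_nbhd :: "(nat \<Rightarrow> real set) \<Rightarrow> (nat \<Rightarrow> real) \<Rightarrow> real set" where
  "limsup_nbhd C r = {x. \<exists>\<^sub>\<infinity>n. \<exists>c\<in>C n. \<bar>x - c\<bar> < r n}"

lemma limsup_nbhd_alt:
  "limsup_nbhd C r = (\<Inter>k. \<Union>n\<in>{k..}. \<Union>c\<in>C n. ball c (r n))"
  by (auto simp: limsup_nbhd_def INFM_nat_le dist_real_def abs_minus_commute Bex_def)

lemma limsup_nbhd_borel [measurable]: "limsup_nbhd C r \<in> sets borel"
  unfolding limsup_nbhd_alt by (intro sets.countable_INT' image_subsetI borel_open open_UN) auto

text \<open>Slope \<open>p\<close> multiplies the distance to a centre by \<open>p\<close>, so the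
  radii grow along with the centres; \<open>limsup_nbhd_scale\<close> undoes this growth up to a
  null set.\<close>

lemma limsup_nbhd_affine:
  fixes p :: real
  assumes "x \<in> limsup_nbhd C r" "p > 0" "\<And>n c. c \<in> C n \<Longrightarrow> p * c + b \<in> C' n"
  shows "p * x + b \<in> limsup_nbhd C' (\<lambda>n. p * r n)"
proof -
  have "\<exists>c'\<in>C' n. \<bar>p * x + b - c'\<bar> < p * r n" if "\<exists>c\<in>C n. \<bar>x - c\<bar> < r n" for n
  proof -
    from that obtain c where c: "c \<in> C n" "\<bar>x - c\<bar> < r n" by blast
    have "\<bar>p * x + b - (p * c + b)\<bar> = p * \<bar>x - c\<bar>"
      using \<open>p > 0\<close> by (simp add: abs_mult flip: right_diff_distrib)
    then show ?thesis using c assms(2,3) by (metis mult_strict_left_mono)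
  qed
  then show ?thesis
    using assms(1) by (auto simp: limsup_nbhd_def elim!: INFM_mono[rotated] frequently_mono)
qed

text \<open>Fix \<open>J\<close> and consider the points of the large limsup set that avoid all
  small balls of index at least \<open>J\<close>. Each lies in large balls of arbitrarily small
  radius whose concentric small ball contains no such point. These points thus fill at most the
  proportion \<open>1 - 1 / K\<close> of those balls, and the density criterion applies.\<close>

lemma limsup_nbhd_scale:
  fixes C :: "nat \<Rightarrow> real set"
  assumes r: "r \<longlonglongrightarrow> 0" and K: "K \<ge> 1"
  shows "AE x in lborel. x \<in> limsup_nbhd C (\<lambda>n. K * r n) \<longrightarrow> x \<in> limsup_nbhd C r"
proof -
  let ?W = "limsup_nbhd C (\<lambda>n. K * r n)"
  \<comment> \<open>The cut at \<open>R\<close> makes the measure finite; countably many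
    \<open>J\<close> and \<open>R\<close> exhaust the exceptional points.\<close>
  define D where "D J R =
    (?W - (\<Union>n\<in>{J..}. \<Union>c\<in>C n. ball c (r n))) \<inter> {-real R..real R}" for J R :: nat
  have D_borel: "D J R \<in> sets borel" for J R
    unfolding D_def
    by (intro sets.Int sets.Diff limsup_nbhd_borel borel_closed[OF closed_atLeastAtMost]
      borel_open open_UN) auto
  have "D J R \<in> null_sets lborel" for J R
  proof -
    have "emeasure lborel (D J R) \<le> emeasure lborel {-real R..real R}"
      by (intro emeasure_mono) (auto simp: D_def)
    then have fin: "emeasure lborel (D J R) < \<infinity>" by (auto intro: le_less_trans)
    have "emeasure lborel (D J R) = 0"
    proof (rule null_if_upper_density_lt_1[OF D_borel fin, of "1 - 1 / K"])
      fix x d :: real assume x: "x \<in> D J R" and "d > 0"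
      have "(\<lambda>n. K * r n) \<longlonglongrightarrow> K * 0" by (intro tendsto_intros r)
      then have "\<forall>\<^sub>F n in sequentially. K * r n < d" 
        using \<open>d > 0\<close> by (simp add: order_tendstoD)
      then obtain N where N: "\<And>n. n \<ge> N \<Longrightarrow> K * r n < d" by (auto simp: eventually_sequentially)
      have "x \<in> ?W" using x by (simp add: D_def)
      then obtain n c where n: "n \<ge> max N J" "c \<in> C n" "\<bar>x - c\<bar> < K * r n"
        unfolding limsup_nbhd_def INFM_nat_le by blast
      \<comment> \<open>\<open>r\<close> may take any sign; positivity at this \<open>n\<close>
        comes from the ball that contains \<open>x\<close>.\<close>
      have "K * r n > 0" using n(3) by linarith
      then have rn: "r n > 0" using K by (simp add: zero_less_mult_iff)
      have le: "r n \<le> K * r n" using K rn by simp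
      have "D J R \<inter> ball c (K * r n) \<subseteq> ball c (K * r n) - ball c (r n)"
        using n(1,2) by (fastforce simp: D_def)
      then have "emeasure lborel (D J R \<inter> ball c (K * r n)) \<le>
        emeasure lborel (ball c (K * r n) - ball c (r n))"
        by (intro emeasure_mono) auto
      also have "\<dots> = emeasure lborel (ball c (K * r n)) - emeasure lborel (ball c (r n))"
        using le rn by (intro emeasure_Diff subset_ball) (auto simp: ball_eq_greaterThanLessThan)
      also have "\<dots> = ennreal (2 * (K * r n) - 2 * r n)"
        using le rn by (simp add: ball_eq_greaterThanLessThan ennreal_minus)
      also have "\<dots> = ennreal ((1 - 1/K) * (2 * (K * r n)))"
        using K by (intro arg_cong[where f = ennreal]) (simp add: field_simps)
      also have "\<dots> = ennreal (1 - 1/K) * emeasure lborel (ball c (K * r n))"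
        using K rn by (subst ennreal_mult) (auto simp: ball_eq_greaterThanLessThan)
      finally show "\<exists>c \<rho>. x \<in> ball c \<rho> \<and> \<rho> < d \<and>
        emeasure lborel (D J R \<inter> ball c \<rho>) \<le> ennreal (1 - 1/K) * emeasure lborel (ball c \<rho>)"
        using n N[of n] by (intro exI[of _ c]
          exI[of _ "K * r n"]) (auto simp: dist_real_def abs_minus_commute)
    qed (use K in auto)
    then show ?thesis using D_borel by (auto simp: null_sets_def)
  qed
  then have "AE x in lborel. \<forall>J R. x \<notin> D J R"
    by (auto simp: AE_all_countable intro: AE_not_in)
  then show ?thesis
  proof eventually_elim
    case (elim x)
    obtain R :: nat where "\<bar>x\<bar> \<le> real R" using real_arch_simple by blast
    then have "x \<in> {-real R..real R}" by auto
    then show ?case using elim unfolding D_def limsup_nbhd_alt[of C r] by blast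
  qed
qed

subsection \<open>Almost everywhere periodic sets\<close>

lemma emeasure_lborel_affine_preimage:
  fixes F :: "real set" and c t :: real
  assumes "c > 0" "F \<in> sets borel"
  shows "emeasure lborel F = ennreal c * emeasure lborel {x. t + c * x \<in> F}"
proof -
  have "emeasure lborel F =
    emeasure (density (distr lborel borel (\<lambda>x. t + c * x)) (\<lambda>_. ennreal \<bar>c\<bar>)) F"
    using lborel_real_affine[of c t] assms by simp
  also have "\<dots> = ennreal c * emeasure lborel {x. t + c * x \<in> F}"
    using assms by (subst emeasure_density_const) (auto simp: emeasure_distr vimage_def)
  finally show ?thesis .
qed

lemma emeasure_Int_periodic:
  fixes F :: "real set"
  assumes F: "F \<in> sets borel" and per: "AE x in lborel. x + t \<in> F \<longleftrightarrow> x \<in> F"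
  shows "emeasure lborel (F \<inter> {a + t..<b + t}) = emeasure lborel (F \<inter> {a..<b})"
proof -
  note [measurable] = F
  have "emeasure lborel (F \<inter> {a + t..<b + t}) = emeasure lborel {x. x + t \<in> F \<and> x \<in> {a..<b}}"
    using emeasure_lborel_affine_preimage[of 1 "F \<inter> {a + t..<b + t}" t] F by (simp add: add.commute)
  also have "\<dots> = emeasure lborel (F \<inter> {a..<b})"
    using per by (intro emeasure_eq_AE) auto
  finally show ?thesis .
qed

lemma emeasure_Int_steps:
  fixes F :: "real set" and t :: real
  assumes F: "F \<in> sets borel" and per: "AE x in lborel. x + t \<in> F \<longleftrightarrow> x \<in> F" and "t \<ge> 0"
  shows "emeasure lborel (F \<inter> {a..<a + real k * t}) = of_nat k * emeasure lborel (F \<inter> {a..<a + t})"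
proof (induction k)
  case (Suc k)
  have 1: "emeasure lborel (F \<inter> {a + real j * t..<a + real (Suc j) * t}) =
    emeasure lborel (F \<inter> {a..<a + t})" for j
  proof (induction j)
    case (Suc j)
    then show ?case
      using emeasure_Int_periodic[OF F per, of "a + real j * t" "a + real (Suc j) * t"]
      by (simp add: algebra_simps)
  qed simp
  have "F \<inter> {a..<a + real (Suc k) * t} =
    (F \<inter> {a..<a + real k * t}) \<union> (F \<inter> {a + real k * t..<a + real (Suc k) * t})"
    using \<open>t \<ge> 0\<close>
      by (auto simp: algebra_simps intro: add_increasing2) (smt (verit) mult_nonneg_nonneg of_nat_0_le_iff)
  then have "emeasure lborel (F \<inter> {a..<a + real (Suc k) * t}) =
     emeasure lborel (F \<inter> {a..<a + real k * t}) + emeasure lborel (F \<inter> {a + real k * t..<a + real (Suc k) * t})"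
    using F by (simp only:) (intro plus_emeasure[symmetric]; auto)
  then show ?case using Suc.IH 1[of k] by (simp add: algebra_simps)
qed auto


text \<open>For \<open>a \<le> b\<close>, split the interval from \<open>a\<close> to
  \<open>b + t\<close> once at \<open>a + t\<close> and once at \<open>b\<close>. The pieces from
  \<open>a\<close> to \<open>b\<close> and from \<open>a + t\<close> to \<open>b + t\<close> carry
  equal finite measure and cancel.\<close>

lemma emeasure_Int_period_shift:
  fixes F :: "real set" and t :: real
  assumes F: "F \<in> sets borel" and per: "AE x in lborel. x + t \<in> F \<longleftrightarrow> x \<in> F" and "t \<ge> 0"
  shows "emeasure lborel (F \<inter> {a..<a + t}) = emeasure lborel (F \<inter> {b..<b + t})"
proof -
  have fin: "emeasure lborel (F \<inter> {c..<d}) \<noteq> \<infinity>" if "c \<le> d" for c d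
  proof -
    have "emeasure lborel (F \<inter> {c..<d}) \<le> emeasure lborel {c..<d}"
      by (intro emeasure_mono) auto
    then show ?thesis using that by (auto simp: top_unique)
  qed
  have split: "emeasure lborel (F \<inter> {c..<e}) =
    emeasure lborel (F \<inter> {c..<d}) + emeasure lborel (F \<inter> {d..<e})"
    if "c \<le> d" "d \<le> e" for c d e
  proof -
    have "F \<inter> {c..<e} = (F \<inter> {c..<d}) \<union> (F \<inter> {d..<e})" using that by auto
    then show ?thesis using F by (simp only:) (intro plus_emeasure[symmetric]; auto)
  qed
  have "emeasure lborel (F \<inter> {a..<a + t}) = emeasure lborel (F \<inter> {b..<b + t})" if "a \<le> b" for a b
    using split[of a "a + t" "b + t"] split[of a b "b + t"] emeasure_Int_periodic[OF F per, of a b]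
      fin[OF that] that \<open>t \<ge> 0\<close> by (simp add: add.commute ennreal_add_left_cancel)
  then show ?thesis by (metis linear)
qed

text \<open>Every interval contains the same proportion \<open>\<delta>\<close> of \<open>F\<close>, so Lebesgue measure restricted to \<open>F\<close>
  is \<open>\<delta>\<close> times Lebesgue measure; for \<open>\<delta> > 0\<close>, evaluating both at \<open>- F\<close> shows that \<open>- F\<close> is null.\<close>

lemma null_or_conull_if_AE_periodic:
  fixes F :: "real set"
  assumes F: "F \<in> sets borel"
    and per: "\<And>k. \<exists>N>k. AE x in lborel. x + 1 / real N \<in> F \<longleftrightarrow> x \<in> F"
  shows "(AE x in lborel. x \<notin> F) \<or> (AE x in lborel. x \<in> F)"
proof -
  note [measurable] = F
  define g where "g a b = measure lborel (F \<inter> {a..<b})" for a b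
  have g: "emeasure lborel (F \<inter> {a..<b}) = ennreal (g a b)" for a b
  proof -
    have "emeasure lborel (F \<inter> {a..<b}) \<le> emeasure lborel {a..<max a b}"
      by (intro emeasure_mono) auto
    then show ?thesis unfolding g_def
      by (intro emeasure_eq_ennreal_measure) (auto simp: top_unique)
  qed
  have g_nonneg: "g a b \<ge> 0" for a b by (simp add: g_def)
  have g_mono: "g a b \<le> g a c" if "b \<le> c" for a b c
  proof -
    have "ennreal (g a b) \<le> ennreal (g a c)"
      unfolding g[symmetric] using that by (intro emeasure_mono) auto
    then show ?thesis using g_nonneg by (simp add: ennreal_le_iff)
  qed
  define \<delta> where "\<delta> = g 0 1"
  \<comment> \<open>The interval contains \<open>k\<close> and is contained in \<open>k + 1\<close>
    consecutive steps of length \<open>1 / real N\<close>, each carrying mass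
    \<open>\<delta> / real N\<close>, so the error is at most one step.\<close>
  have near: "\<bar>g l u - (u - l) * \<delta>\<bar> \<le> \<delta> / real N"
    if N: "N > 0" "AE x in lborel. x + 1 / real N \<in> F \<longleftrightarrow> x \<in> F" and "l \<le> u" for l u N
  proof -
    have step: "g a (a + real k * (1 / real N)) = real k * g a (a + 1 / real N)" for a k
    proof -
      have "ennreal (g a (a + real k * (1 / real N))) = ennreal (real k * g a (a + 1 / real N))"
        using emeasure_Int_steps[OF F N(2), of a k]
          by (simp add: g ennreal_mult' ennreal_of_nat_eq_real_of_nat)
      then show ?thesis using g_nonneg by simp
    qed
    have "g a (a + 1 / real N) = g 0 (0 + 1 / real N)" for a
      using emeasure_Int_period_shift[OF F N(2), of a 0] g_nonneg by (simp add: g)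
    moreover have "\<delta> = real N * g 0 (0 + 1 / real N)"
      using step[of 0 N] N(1) by (simp add: \<delta>_def)
    ultimately have unit: "g a (a + 1 / real N) = \<delta> / real N" for a
      using N(1) by (simp add: field_simps)
    define k where "k = nat \<lfloor>real N * (u - l)\<rfloor>"
    have k: "real k \<le> real N * (u - l)" "real N * (u - l) < real k + 1"
      using \<open>l \<le> u\<close> by (auto simp: k_def)
    have "g l (l + real k * (1 / real N)) \<le> g l u"
      using k N(1) by (intro g_mono) (simp add: field_simps)
    then have lo: "real k * (\<delta> / real N) \<le> g l u" using step[of l k] unit by simp
    have "g l u \<le> g l (l + real (Suc k) * (1 / real N))"
      using k N(1) by (intro g_mono) (simp add: field_simps)
    then have hi: "g l u \<le> (real k + 1) * (\<delta> / real N)"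
      using step[of l "Suc k"] unit by (simp add: add.commute)
    have d: "\<delta> / real N \<ge> 0" using g_nonneg by (simp add: \<delta>_def)
    have eq: "(u - l) * \<delta> = (real N * (u - l)) * (\<delta> / real N)" using N(1) by simp
    have "real k * (\<delta> / real N) \<le> (u - l) * \<delta>" "(u - l) * \<delta> \<le> (real k + 1) * (\<delta> / real N)"
      unfolding eq using k d by (auto intro!: mult_right_mono simp del: times_divide_eq_right)
    then show ?thesis using lo hi unfolding distrib_right abs_le_iff by linarith
  qed
  have g_eq: "g l u = (u - l) * \<delta>" if "l \<le> u" for l u
  proof -
    have "\<bar>g l u - (u - l) * \<delta>\<bar> \<le> 0 + e" if "e > 0" for e
    proof -
      obtain k :: nat where k: "\<delta> / e < real k" using reals_Archimedean2 by blast
      obtain N where N: "N > k" "AE x in lborel. x + 1 / real N \<in> F \<longleftrightarrow> x \<in> F" using per by blast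
      have "\<delta> / e < real N" using k N(1) by simp
      then have "\<delta> / real N < e" using N(1) \<open>e > 0\<close> by (simp add: field_simps)
      then show ?thesis using near[OF _ N(2) \<open>l \<le> u\<close>] N(1) by simp
    qed
    then have "\<bar>g l u - (u - l) * \<delta>\<bar> \<le> 0" by (rule field_le_epsilon)
    then show ?thesis by simp
  qed
  show ?thesis
  proof (cases "\<delta> = 0")
    case True
    have "AE x in lborel. \<forall>k::nat. x \<notin> F \<inter> {-real k..<real k}"
      using g_eq True by (auto simp: AE_all_countable null_sets_def g simp del: Int_iff intro!: AE_not_in)
    then have "AE x in lborel. x \<notin> F"
    proof eventually_elim
      case (elim x)
      obtain k :: nat where "\<bar>x\<bar> < real k" using reals_Archimedean2 by blast
      then have "x \<in> {-real k..<real k}" by auto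
      then show ?case using elim by blast
    qed
    then show ?thesis by blast
  next
    case False
    then have "\<delta> > 0" using g_nonneg[of 0 1] by (simp add: \<delta>_def)
    define M where "M = density lborel (\<lambda>x. ennreal (1 / \<delta>) * indicator F x)"
    have M: "emeasure M A = ennreal (1 / \<delta>) * emeasure lborel (F \<inter> A)"
      if [measurable]: "A \<in> sets borel" for A
    proof -
      have "emeasure M A = (\<integral>\<^sup>+x. ennreal (1 / \<delta>) * indicator (F \<inter> A) x \<partial>lborel)"
        unfolding M_def by (subst emeasure_density) (auto simp: indicator_inter_arith mult.assoc)
      then show ?thesis by (simp add: nn_integral_cmult_indicator)
    qed
    have "lborel = M"
    proof (rule lborel_eqI)
      fix l u :: real assume "\<And>b. b \<in> Basis \<Longrightarrow> l \<bullet> b \<le> u \<bullet> b"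
      then have "l \<le> u" by simp
      \<comment> \<open>Boxes are open while \<open>g\<close> measures half-open intervals; the
        endpoint \<open>l\<close> is null.\<close>
      have "emeasure lborel (F \<inter> {l<..<u}) = emeasure lborel (F \<inter> {l..<u})"
        using AE_lborel_singleton[of l] by (intro emeasure_eq_AE) auto
      then have "emeasure M (box l u) = ennreal (1 / \<delta>) * ennreal ((u - l) * \<delta>)"
        using M[of "{l<..<u}"] g_eq[OF \<open>l \<le> u\<close>] by (simp add: g box_real)
      also have "\<dots> = ennreal (u - l)"
        using \<open>\<delta> > 0\<close> \<open>l \<le> u\<close> by (simp flip: ennreal_mult)
      finally show "emeasure M (box l u) = ennreal (\<Prod>b\<in>Basis. (u - l) \<bullet> b)" by simp
    qed (simp add: M_def)
    then have "emeasure lborel (- F) = 0" using M[of "- F"] by simp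
    then have "AE x in lborel. x \<notin> - F" by (intro AE_not_in) (auto simp: null_sets_def)
    then show ?thesis by simp
  qed
qed

text \<open>The preimage \<open>G\<close> of \<open>F\<close> under the map contains
  \<open>F\<close>, and the map preserves measure modulo 1, so \<open>F\<close> and \<open>G\<close>
  agree almost everywhere. The map turns a translation by \<open>1 / p ^ Suc j\<close> into one by
  \<open>1 / p ^ j\<close>, so by induction \<open>F\<close> has all periods
  \<open>1 / p ^ j\<close> almost everywhere.\<close>

lemma null_or_conull_if_expanding_invariant:
  fixes F :: "real set" and p :: nat
  assumes F: "F \<in> sets borel" and p: "p \<ge> 2"
    and per: "\<And>x. x + 1 \<in> F \<longleftrightarrow> x \<in> F"
    and inv: "\<And>x. x \<in> F \<Longrightarrow> real p * x + b \<in> F"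
  shows "(AE x in lborel. x \<notin> F) \<or> (AE x in lborel. x \<in> F)"
proof -
  note [measurable] = F
  have perp: "x + real j \<in> F \<longleftrightarrow> x \<in> F" for x j
    by (induction j) (use per in \<open>auto simp flip: add.assoc simp: add.commute[of 1]\<close>)
  define G where "G = {x. b + real p * x \<in> F}"
  have G[measurable]: "G \<in> sets borel" unfolding G_def by measurable
  have FG: "F \<subseteq> G" using inv by (auto simp: G_def add.commute)
  have perG: "x + 1 \<in> G \<longleftrightarrow> x \<in> G" for x
    using perp[of "b + real p * x" p] by (simp add: G_def algebra_simps)
  have fin: "emeasure lborel (A \<inter> {0..<1}) \<noteq> \<infinity>" for A :: "real set"
  proof -
    have "emeasure lborel (A \<inter> {0..<1}) \<le> emeasure lborel {0..<1::real}"
      by (intro emeasure_mono) auto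
    then show ?thesis by (auto simp: top_unique)
  qed
  \<comment> \<open>The map stretches a unit interval to length \<open>p\<close>, where
    \<open>F\<close> has \<open>p\<close> portions of equal mass; hence \<open>G\<close> and
    \<open>F\<close> carry the same mass per period.\<close>
  have "of_nat p * emeasure lborel (G \<inter> {0..<1}) =
    ennreal (real p) * emeasure lborel {x. b + real p * x \<in> F \<inter> {b..<b + real p * 1}}"
    using p by (auto simp: G_def ennreal_of_nat_eq_real_of_nat mult_less_cancel_left1 zero_le_mult_iff
       intro!: arg_cong2[where f = "(*)"] arg_cong[where f = "emeasure lborel"])
  also have "\<dots> = emeasure lborel (F \<inter> {b..<b + real p * 1})"
    using p by (intro emeasure_lborel_affine_preimage[symmetric]) auto
  also have "\<dots> = of_nat p * emeasure lborel (F \<inter> {b..<b + 1})"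
    using per by (intro emeasure_Int_steps) auto
  also have "emeasure lborel (F \<inter> {b..<b + 1}) = emeasure lborel (F \<inter> {0..<0 + 1})"
    using per by (intro emeasure_Int_period_shift) auto
  finally have "emeasure lborel (G \<inter> {0..<1}) = emeasure lborel (F \<inter> {0..<1})"
    using p by (simp add: ennreal_mult_cancel_left)
  moreover have "emeasure lborel (G \<inter> {0..<1} - F \<inter> {0..<1}) =
      emeasure lborel (G \<inter> {0..<1}) - emeasure lborel (F \<inter> {0..<1})"
    using FG fin by (intro emeasure_Diff) auto
  ultimately have "emeasure lborel (G \<inter> {0..<1} - F \<inter> {0..<1}) = 0" using fin by simp
  also have "G \<inter> {0..<1} - F \<inter> {0..<1} = (G - F) \<inter> {0..<0 + 1}" by auto
  finally have 0: "emeasure lborel ((G - F) \<inter> {0..<0 + 1}) = 0" .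
  have perD: "AE x in lborel. x + 1 \<in> G - F \<longleftrightarrow> x \<in> G - F" using per perG by simp
  \<comment> \<open>\<open>G - F\<close> is null on one period and 1-periodic, hence null on every
    bounded interval.\<close>
  have "emeasure lborel ((G - F) \<inter> {- real k..<- real k + real (2 * k) * 1}) = 0" for k
    using emeasure_Int_steps[OF _ perD, of "- real k" "2 * k"]
      emeasure_Int_period_shift[OF _ perD, of "- real k" 0] 0
    by simp
  then have "AE x in lborel. \<forall>k::nat. x \<notin> (G - F) \<inter> {-real k..<- real k + real (2 * k) * 1}"
    by (auto simp: AE_all_countable null_sets_def simp del: Int_iff intro!: AE_not_in)
  then have GF: "AE x in lborel. x \<in> F \<longleftrightarrow> b + real p * x \<in> F"
  proof eventually_elim
    case (elim x)
    obtain k :: nat where "\<bar>x\<bar> < real k" using reals_Archimedean2 by blast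
    then have "x \<in> {-real k..<- real k + real (2 * k) * 1}" by auto
    then show ?case using elim FG by (auto simp: G_def)
  qed
  have perj: "AE x in lborel. x + 1 / real (p ^ j) \<in> F \<longleftrightarrow> x \<in> F" for j
  proof (induction j)
    case 0
    then show ?case using per by simp
  next
    case (Suc j)
    have "AE x in lborel. (b + real p * x) + 1 / real (p ^ j) \<in> F \<longleftrightarrow> b + real p * x \<in> F"
      using p by (intro AE_borel_affine[OF _ _ Suc]) auto
    \<comment> \<open>\<open>GF\<close> is used both at \<open>x\<close> and at its translate; the
      factor \<open>1 * x\<close> matches the affine form of \<open>AE_borel_affine\<close>.\<close>
    moreover have "AE x in lborel. (1 / real (p ^ Suc j) + 1 * x) \<in> F \<longleftrightarrow>
      b + real p * (1 / real (p ^ Suc j) + 1 * x) \<in> F"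
      by (intro AE_borel_affine[OF _ _ GF]) auto
    ultimately show ?case using GF
    proof eventually_elim
      case (elim x)
      have "b + real p * (1 / real (p ^ Suc j) + 1 * x) = (b + real p * x) + 1 / real (p ^ j)"
        using p by (simp add: field_simps)
      then show ?case using elim by (simp only: add.commute mult_1)
    qed
  qed
  have "\<exists>N>k. AE x in lborel. x + 1 / real N \<in> F \<longleftrightarrow> x \<in> F" for k
    using perj[of k] p
      by (intro exI[of _ "p ^ k"]) (auto intro: less_exp order.strict_trans2 power_mono)
  then show ?thesis by (intro null_or_conull_if_AE_periodic F) auto
qed

subsection \<open>Gaps between integers coprime to \<open>n\<close>\<close>

lemma card_ints_in_interval:
  assumes "u \<le> v"
  shows "\<bar>real (card {a :: int. u \<le> of_int a \<and> of_int a < v}) - (v - u)\<bar> \<le> 1"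
proof -
  have "{a :: int. u \<le> of_int a \<and> of_int a < v} = {\<lceil>u\<rceil>..<\<lceil>v\<rceil>}"
    by (auto simp: ceiling_le_iff less_ceiling_iff)
  moreover have "\<lceil>u\<rceil> \<le> \<lceil>v\<rceil>" using assms by (rule ceiling_mono)
  ultimately have "real (card {a :: int. u \<le> of_int a \<and> of_int a < v}) = of_int \<lceil>v\<rceil> - of_int \<lceil>u\<rceil>"
    by simp
  then show ?thesis by linarith
qed

lemma finite_ints_in_interval:
  fixes u v :: real
  shows "finite {a :: int. u \<le> of_int a \<and> of_int a < v \<and> P a}"
proof (rule finite_subset)
  show "{a :: int. u \<le> of_int a \<and> of_int a < v \<and> P a} \<subseteq> {\<lceil>u\<rceil>..<\<lceil>v\<rceil>}"
    by (auto simp: ceiling_le_iff less_ceiling_iff)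
qed auto

text \<open>Primes are sieved one at a time: the survivors divisible by the new prime
  \<open>p\<close> are \<open>p\<close> times the survivors in the interval scaled by
  \<open>1 / p\<close>, which is why \<open>u\<close> and \<open>v\<close> vary in the induction.
  Subtracting two counts of equal error doubles the error.\<close>

lemma sieve_count:
  fixes P :: "nat set" and u v :: real
  assumes "finite P" "\<And>p. p \<in> P \<Longrightarrow> prime p" "u \<le> v"
  shows "\<bar>real (card {a :: int. u \<le> of_int a \<and> of_int a < v \<and> (\<forall>p\<in>P. \<not> int p dvd a)})
           - (v - u) * (\<Prod>p\<in>P. 1 - 1 / real p)\<bar> \<le> 2 ^ card P"
  using assms
proof (induction P arbitrary: u v rule: finite_induct)
  case empty
  then show ?case using card_ints_in_interval[of u v] by simp
next
  case (insert p P)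
  define N where "N u v =
    {a :: int. u \<le> of_int a \<and> of_int a < v \<and> (\<forall>p\<in>P. \<not> int p dvd a)}" for u v :: real
  define \<pi> where "\<pi> = (\<Prod>p\<in>P. 1 - 1 / real p)"
  have "prime p" using insert by blast
  then have p: "p > 0" by (rule prime_gt_0_nat)
  have cop: "int q dvd b" if "q \<in> P" "int q dvd int p * b" for q b
  proof -
    have "coprime q p" using insert \<open>prime p\<close> that by (metis insertI2 primes_coprime)
    then show ?thesis using that by (simp add: coprime_dvd_mult_right_iff)
  qed
  have fin: "finite (N u v)" for u v unfolding N_def by (rule finite_ints_in_interval)
  let ?M = "{a :: int. u \<le> of_int a \<and> of_int a < v \<and> (\<forall>q\<in>insert p P. \<not> int q dvd a)}"
  have M: "?M = N u v - (*) (int p) ` N (u / p) (v / p)"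
  proof (intro equalityI subsetI)
    fix a assume "a \<in> ?M"
    then show "a \<in> N u v - (*) (int p) ` N (u / p) (v / p)" by (auto simp: N_def)
  next
    fix a assume a: "a \<in> N u v - (*) (int p) ` N (u / p) (v / p)"
    have "\<not> int p dvd a"
    proof
      assume "int p dvd a"
      then obtain b where b: "a = int p * b" by blast
      have "b \<in> N (u / p) (v / p)" using a p unfolding b by (auto simp: N_def field_simps)
      then show False using a b by blast
    qed
    then show "a \<in> ?M" using a by (auto simp: N_def)
  qed
  have sub: "(*) (int p) ` N (u / p) (v / p) \<subseteq> N u v"
  proof
    fix a assume "a \<in> (*) (int p) ` N (u / p) (v / p)"
    then obtain b where b: "a = int p * b" "b \<in> N (u / p) (v / p)" by blast
    have "u \<le> of_int a" "of_int a < v"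
      using b p by (auto simp: N_def pos_divide_le_eq pos_less_divide_eq mult.commute)
    then show "a \<in> N u v" using b cop unfolding N_def by blast
  qed
  have "card ?M = card (N u v) - card ((*) (int p) ` N (u / p) (v / p))"
    unfolding M using sub fin by (intro card_Diff_subset finite_subset[OF sub]) auto
  also have "card ((*) (int p) ` N (u / p) (v / p)) = card (N (u / p) (v / p))"
    using p by (intro card_image) (auto simp: inj_on_def)
  \<comment> \<open>The inclusion \<open>sub\<close> makes the difference of cardinals exact, so it
    passes to the reals.\<close>
  finally have card: "real (card ?M) = real (card (N u v)) - real (card (N (u / p) (v / p)))"
    using card_mono[OF fin sub] p card_image[of "(*) (int p)" "N (u / p) (v / p)"]
    by (auto simp: inj_on_def)
  have 1: "\<bar>real (card (N u v)) - (v - u) * \<pi>\<bar> \<le> 2 ^ card P"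
    unfolding N_def \<pi>_def using insert by blast
  have 2: "\<bar>real (card (N (u / p) (v / p))) - (v / p - u / p) * \<pi>\<bar> \<le> 2 ^ card P"
    unfolding N_def \<pi>_def using insert p by (intro insert.IH) (auto intro: divide_right_mono)
  have eq: "(v - u) * (\<Prod>q\<in>insert p P. 1 - 1 / real q) = (v - u) * \<pi> - (v / p - u / p) * \<pi>"
    using insert by (simp add: \<pi>_def algebra_simps diff_divide_distrib)
  show ?case unfolding card eq using 1 2 insert(1,2) by (simp add: abs_le_iff)
qed

text \<open>The exponent comes from the crude bound 16 on the number of prime factors that are at most 16.\<close>

lemma card_prime_factors_bound:
  fixes n :: nat assumes "n > 0"
  shows "16 ^ card (prime_factors n) \<le> 16 ^ 16 * n"
proof -
  define A where "A = {p \<in> prime_factors n. p < 17}"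
  define B where "B = {p \<in> prime_factors n. p \<ge> 17}"
  have AB: "prime_factors n = A \<union> B" "A \<inter> B = {}" "finite A" "finite B" by (auto simp: A_def B_def)
  have "A \<subseteq> {1..16}"
    by (auto simp: A_def dest!: in_prime_factors_imp_prime intro: prime_ge_Suc_0_nat)
  then have "card A \<le> 16" using card_mono[of "{1..16::nat}" A] by simp
  have "16 ^ card B = (\<Prod>p\<in>B. 16::nat)" by simp
  also have "\<dots> \<le> \<Prod>B" by (intro prod_mono) (auto simp: B_def)
  also have "\<dots> \<le> n"
  proof (rule dvd_imp_le)
    have "\<Prod>B dvd \<Prod>(prime_factors n)" by (intro prod_dvd_prod_subset) (auto simp: B_def)
    also have "\<Prod>(prime_factors n) dvd (\<Prod>p\<in>prime_factors n. p ^ multiplicity p n)"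
      by (intro prod_dvd_prod dvd_power)
        (auto simp: prime_factors_multiplicity)
    also have "\<dots> = n" using assms by (simp add: prime_factorization_nat[symmetric])
    finally show "\<Prod>B dvd n" .
  qed (use assms in auto)
  finally have "16 ^ card A * 16 ^ card B \<le> (16::nat) ^ 16 * n"
    using \<open>card A \<le> 16\<close> by (intro mult_mono power_increasing) auto
  then show ?thesis using AB by (simp add: card_Un_disjoint power_add)
qed

text \<open>With \<open>w\<close> prime factors, the sieve has main term at least
  \<open>c * n / 2 ^ w\<close> and error at most \<open>2 ^ w\<close>. The main term wins once
  \<open>4 ^ w < c * n\<close>; after squaring, this follows for large \<open>n\<close> from the
  bound on \<open>16 ^ w\<close>. The threshold does not depend on \<open>u\<close>.\<close>

lemma coprime_in_long_interval:
  fixes c :: real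
  assumes c: "c > 0"
  shows "\<forall>\<^sub>F n in sequentially. \<forall>u. \<exists>a :: int. coprime a (int n) \<and> u \<le>
    of_int a \<and> of_int a < u + c * real n"
proof -
  \<comment> \<open>Chosen so that \<open>16 ^ 16 * n < (c * n)\<^sup>2\<close> for positive
    \<open>n \<ge> N\<close>.\<close>
  obtain N :: nat where N: "16 ^ 16 / c\<^sup>2 < real N" using reals_Archimedean2 by blast
  have "\<exists>a :: int. coprime a (int n) \<and> u \<le> of_int a \<and> of_int a < u + c * real n"
    if n: "n \<ge> max N 1" for n u
  proof -
    let ?P = "prime_factors n"
    let ?w = "card ?P"
    define A where "A =
      {a :: int. u \<le> of_int a \<and> of_int a < u + c * real n \<and> (\<forall>p\<in>?P. \<not> int p dvd a)}"
    have "16 ^ 16 / c\<^sup>2 < real n" using N n by linarith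
    then have big: "16 ^ 16 < c\<^sup>2 * real n" using c by (simp add: field_simps)
    have "real (16 ^ ?w) \<le> real (16 ^ 16 * n)"
      using card_prime_factors_bound[of n] n by (intro of_nat_mono) auto
    then have "(4 ^ ?w)\<^sup>2 \<le> 16 ^ 16 * real n"
      by (simp add: power_mult_distrib flip: power_mult) (simp add: power_mult mult.commute)
    also have "\<dots> < c\<^sup>2 * real n * real n" using n by (intro mult_strict_right_mono big) auto
    also have "\<dots> = (c * real n)\<^sup>2" by (simp add: power2_eq_square)
    finally have "4 ^ ?w < c * real n"
      using c by (intro power_less_imp_less_base[of "4 ^ ?w" 2]) auto
    then have "4 ^ ?w * (1 / 2) ^ ?w < c * real n * (1 / 2) ^ ?w"
      by (intro mult_strict_right_mono) auto
    then have "2 ^ ?w < c * real n * (1 / 2) ^ ?w" by (simp flip: power_mult_distrib)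
    also have "(1 / 2) ^ ?w = (\<Prod>p\<in>?P. 1 / 2 :: real)" by simp
    also have "c * real n * \<dots> \<le> c * real n * (\<Prod>p\<in>?P. 1 - 1 / real p)"
    proof (intro mult_left_mono prod_mono conjI)
      fix p assume "p \<in> ?P"
      then have "p \<ge> 2" by (intro prime_ge_2_nat in_prime_factors_imp_prime)
      then show "1 / 2 \<le> 1 - 1 / real p" by (simp add: field_simps)
    qed (use c in auto)
    finally have "0 < real (card A)"
      using sieve_count[of ?P u "u + c * real n"] c
      by (simp add: in_prime_factors_imp_prime abs_le_iff A_def del: of_nat_0_less_iff)
    then have "A \<noteq> {}" by auto
    then obtain a where a: "a \<in> A" by blast
    have "coprime a (int n)"
    proof (rule ccontr)
      assume "\<not> coprime a (int n)"
      then have "gcd a (int n) \<noteq> 0" "\<not> is_unit (gcd a (int n))"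
        using n by (auto simp: coprime_iff_gcd_eq_1)
      then obtain q where "prime q" "q dvd gcd a (int n)" using prime_divisor_exists by blast
      then have q: "prime q" "q dvd a" "q dvd int n" by auto
      then have "q \<ge> 0" by (simp add: prime_ge_0_int)
      then obtain p where p: "q = int p" by (metis nonneg_eq_int)
      then have "p \<in> ?P" using q n by (auto simp: prime_factors_dvd)
      then show False using a q p by (auto simp: A_def)
    qed
    then show ?thesis using a by (auto simp: A_def)
  qed
  then show ?thesis unfolding eventually_sequentially by blast
qed

subsection \<open>Reduced fractions and their shifts\<close>

text \<open>The condition \<open>n > 0\<close> removes the junk value of the division, for which the shift lemmas fail.\<close>

definition fracs :: "(nat \<Rightarrow> bool) \<Rightarrow> real \<Rightarrow> nat \<Rightarrow> real set" where
  "fracs Q z n = {(of_int a - z) / real n | a :: int. n > 0 \<and> Q n \<and> coprime a (int n)}"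

lemma fracsI:
  "n > 0 \<Longrightarrow> Q n \<Longrightarrow> coprime a (int n) \<Longrightarrow> c = (of_int a - z) / real n \<Longrightarrow> c \<in> fracs Q z n"
  by (auto simp: fracs_def)

text \<open>Divide the inequality by \<open>n\<close>. Each \<open>n\<close> admits only finitely
  many numerators, so infinitely many pairs amount to infinitely many denominators.\<close>

lemma approx_set_eq_limsup_nbhd:
  "approx_set \<psi> z = limsup_nbhd (fracs (\<lambda>_. True) z) (\<lambda>n. \<psi> n / real n)"
proof -
  have eq: "\<bar>real n * x - of_int a + z\<bar> < \<psi> n \<longleftrightarrow> \<bar>x - (of_int a - z) / real n\<bar> < \<psi> n / real n"
    if "n > 0" for x n a
  proof -
    have "real n * ((of_int a - z) / real n) = of_int a - z" using that by simp
    then have "\<bar>real n * x - of_int a + z\<bar> = \<bar>real n * (x - (of_int a - z) / real n)\<bar>"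
      unfolding right_diff_distrib by simp
    also have "\<dots> = real n * \<bar>x - (of_int a - z) / real n\<bar>" by (simp add: abs_mult)
    finally show ?thesis using that by (simp add: pos_less_divide_eq mult.commute)
  qed
  have "x \<in> approx_set \<psi> z \<longleftrightarrow> x \<in> limsup_nbhd (fracs (\<lambda>_. True) z) (\<lambda>n. \<psi> n / real n)" for x
  proof -
    define T where "T = {(a :: int, n :: nat). n \<ge> 1 \<and> gcd a (int n) =
      1 \<and> \<bar>real n * x - of_int a + z\<bar> < \<psi> n}"
    have snd: "snd ` T = {n. \<exists>c\<in>fracs (\<lambda>_. True) z n. \<bar>x - c\<bar> < \<psi> n / real n}"
    proof (intro equalityI subsetI)
      fix n assume "n \<in> snd ` T"
      then obtain a where a: "n \<ge> 1" "coprime a (int n)" "\<bar>real n * x - of_int a + z\<bar> < \<psi> n"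
        by (auto simp: T_def coprime_iff_gcd_eq_1)
      then have "(of_int a - z) / real n \<in> fracs (\<lambda>_. True) z n"
        by (intro fracsI) auto
      then show "n \<in> {n. \<exists>c\<in>fracs (\<lambda>_. True) z n. \<bar>x - c\<bar> < \<psi> n / real n}"
        using a eq[of n x a] by auto
    next
      fix n assume "n \<in> {n. \<exists>c\<in>fracs (\<lambda>_. True) z n. \<bar>x - c\<bar> < \<psi> n / real n}"
      then obtain a :: int where a: "n > 0" "coprime a (int n)"
        "\<bar>x - (of_int a - z) / real n\<bar> < \<psi> n / real n"
        by (auto simp: fracs_def)
      then have "(a, n) \<in> T" using eq[of n x a] by (auto simp: T_def coprime_iff_gcd_eq_1)
      then show "n \<in> snd ` T" by force
    qed
    have "finite (snd -` {n} \<inter> T)" for n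
    proof (rule finite_subset)
      let ?w = "real n * x + z"
      show "snd -` {n} \<inter> T \<subseteq> {\<lfloor>?w - \<psi> n\<rfloor>..\<lceil>?w + \<psi> n\<rceil>} \<times> {n}"
        by (auto simp: T_def abs_less_iff floor_le_iff le_ceiling_iff)
    qed auto
    then have "finite (snd ` T) \<longleftrightarrow> finite T"
      using inf_img_fin_dom'[of snd T] by auto
    moreover have "x \<in> approx_set \<psi> z \<longleftrightarrow> infinite T" by (simp add: approx_set_def T_def)
    moreover have "x \<in> limsup_nbhd (fracs (\<lambda>_. True) z) (\<lambda>n. \<psi> n / real n) \<longleftrightarrow> infinite (snd ` T)"
      unfolding limsup_nbhd_def snd by (simp add: frequently_cofinite)
    ultimately show ?thesis by simp
  qed
  then show ?thesis by blast
qed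

text \<open>Some \<open>c > 0\<close> satisfies \<open>\<psi> n \<ge> c * n\<close> for infinitely
  many \<open>n\<close>. For large such \<open>n\<close>, whatever \<open>x\<close> is, an integer
  coprime to \<open>n\<close> lies less than \<open>c * n / 2\<close> to the right of
  \<open>n * x + z\<close>.\<close>

lemma approx_set_eq_UNIV:
  assumes \<psi>: "\<And>n. n \<ge> 1 \<Longrightarrow> \<psi> n \<ge> 0" and "\<not> (\<lambda>n. \<psi> n / real n) \<longlonglongrightarrow> 0"
  shows "approx_set \<psi> z = UNIV"
proof -
  obtain c where c: "c > 0" "\<not> (\<forall>\<^sub>F n in sequentially. \<bar>\<psi> n / real n\<bar> < c)"
    using assms(2) by (auto simp: tendsto_iff dist_real_def)
  have freq: "\<exists>\<^sub>F n in sequentially. \<not> \<bar>\<psi> n / real n\<bar> < c" using c(2) by (simp add: not_eventually)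
  have "x \<in> limsup_nbhd (fracs (\<lambda>_. True) z) (\<lambda>n. \<psi> n / real n)" for x
  proof -
    have "\<exists>\<^sub>F n in sequentially. \<not> \<bar>\<psi> n / real n\<bar> < c \<and> n \<ge> 1 \<and>
      (\<forall>u. \<exists>a :: int. coprime a (int n) \<and> u \<le> of_int a \<and> of_int a < u + c / 2 * real n)"
      using frequently_eventually_frequently[OF freq eventually_conj[OF eventually_ge_at_top[of 1]
        coprime_in_long_interval[of "c / 2"]]] c(1) by simp
    then have "\<exists>\<^sub>F n in sequentially. \<exists>c\<in>fracs (\<lambda>_. True) z n. \<bar>x - c\<bar> < \<psi> n / real n"
    proof (rule frequently_elim1, elim conjE)
      fix n :: nat assume n: "\<not> \<bar>\<psi> n / real n\<bar> < c" "n \<ge> 1"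
        and ex: "\<forall>u. \<exists>a :: int. coprime a (int n) \<and> u \<le> of_int a \<and> of_int a < u + c / 2 * real n"
      obtain a :: int where a: "coprime a (int n)" "real n * x + z \<le>
        of_int a" "of_int a < real n * x + z + c / 2 * real n"
        using ex by blast
      have "\<psi> n / real n \<ge> c" using n \<psi>[of n] by simp
      moreover have "x \<le> (of_int a - z) / real n" "(of_int a - z) / real n < x + c / 2"
        using a n(2) by (simp_all add: field_simps)
      ultimately have "\<bar>x - (of_int a - z) / real n\<bar> < \<psi> n / real n" using c(1) by linarith
      moreover have "(of_int a - z) / real n \<in> fracs (\<lambda>_. True) z n" using a(1) n(2)
        by (intro fracsI) auto
      ultimately show "\<exists>c\<in>fracs (\<lambda>_. True) z n. \<bar>x - c\<bar> < \<psi> n / real n" by blast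
    qed
    then show ?thesis by (simp add: limsup_nbhd_def cofinite_eq_sequentially)
  qed
  then show ?thesis by (auto simp: approx_set_eq_limsup_nbhd)
qed

text \<open>As \<open>p\<close> is coprime to \<open>n\<close>, a numerator multiplied by
  \<open>p\<close> stays coprime to \<open>n\<close>. The summand 0 gives the shape shared with the
  next lemma.\<close>

lemma fracs_mult_prime:
  assumes "prime p" "c \<in> fracs (\<lambda>n. \<not> p dvd n) z n"
  shows "real p * c + 0 \<in> fracs (\<lambda>n. \<not> p dvd n) (real p * z) n"
proof -
  obtain a :: int where a: "n > 0" "\<not> p dvd n" "coprime a (int n)" "c = (of_int a - z) / real n"
    using assms(2) by (auto simp: fracs_def)
  have "coprime (int p) (int n)" using assms(1) a(2) by (simp add: prime_imp_coprime)
  then have "coprime (int p * a) (int n)" using a(3) by simp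
  then show ?thesis using a by (intro fracsI[of _ _ "int p * a"]) (auto simp: right_diff_distrib)
qed

text \<open>Multiplying the numerator by \<open>p\<close> alone would destroy coprimality with
  \<open>n = p * k\<close>. Adding \<open>1 / p = k / n\<close> makes the numerator
  \<open>p * a + k\<close>, coprime to \<open>p\<close> because \<open>p\<close> does not divide
  \<open>k\<close>, and to \<open>k\<close> because \<open>p * a\<close> is.\<close>

lemma fracs_mult_prime_shift:
  assumes "prime p" "c \<in> fracs (\<lambda>n. p dvd n \<and> \<not> p\<^sup>2 dvd n) z n"
  shows "real p * c + 1 / real p \<in> fracs (\<lambda>n. p dvd n \<and> \<not> p\<^sup>2 dvd n) (real p * z) n"
proof -
  obtain a :: int where a: "n > 0" "p dvd n" "\<not> p\<^sup>2 dvd n" "coprime a (int n)" "c =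
    (of_int a - z) / real n"
    using assms(2) by (auto simp: fracs_def)
  obtain k where k: "n = p * k" using a(2) by blast
  have "\<not> p dvd k" using a(3) by (auto simp: k power2_eq_square)
  then have pk: "coprime (int p) (int k)" using assms(1) by (simp add: prime_imp_coprime)
  have "coprime a (int k)" using a(4) by (simp add: k)
  have "coprime (int p * a + int k) (int p)"
    using pk by (metis add.commute coprime_commute coprime_iff_gcd_eq_1 gcd_add_mult mult.commute)
  moreover have "coprime (int p * a) (int k)" using pk \<open>coprime a (int k)\<close> by simp
  then have "coprime (int p * a + int k) (int k)" by (simp add: coprime_iff_gcd_eq_1)
  ultimately have "coprime (int p * a + int k) (int n)" by (simp add: k)
  moreover have "1 / real p = of_int (int k) / real n" using a(1) by (simp add: k)
  then have "real p * c + 1 / real p = (of_int (int p * a + int k) - real p * z) / real n"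
    unfolding a(5) by (simp add: right_diff_distrib flip: add_divide_distrib)
  ultimately show ?thesis using a by (intro fracsI) auto
qed

text \<open>For \<open>n = p\<^sup>2 * k\<close> the translation adds \<open>s * p * k\<close> to
  the numerator. Since \<open>p * k\<close> has the same prime divisors as \<open>n\<close>,
  coprimality survives.\<close>

lemma fracs_shift:
  assumes "p > 0" "c \<in> fracs (\<lambda>n. p\<^sup>2 dvd n) z n"
  shows "c + of_int s / real p \<in> fracs (\<lambda>n. p\<^sup>2 dvd n) z n"
proof -
  obtain a :: int where a: "n > 0" "p\<^sup>2 dvd n" "coprime a (int n)" "c = (of_int a - z) / real n"
    using assms(2) by (auto simp: fracs_def)
  obtain k where k: "n = p * (p * k)" using a(2) by (metis dvdE mult.assoc power2_eq_square)
  have "coprime a (int (p * k))" using a(3) by (simp add: k)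
  then have "coprime (a + s * int (p * k)) (int (p * k))"
    by (metis coprime_commute coprime_iff_gcd_eq_1 gcd_add_mult add.commute)
  then have "coprime (a + s * int (p * k)) (int n)" by (simp add: k)
  moreover have "of_int s / real p = of_int (s * int (p * k)) / real n"
    using a(1) by (simp add: k)
  ultimately show ?thesis using a
    by (intro fracsI[of _ _ "a + s * int (p * k)"]) (auto simp flip: add_divide_distrib)
qed

lemma fracs_shift_int:
  assumes "c \<in> fracs Q z n"
  shows "c + of_int s \<in> fracs Q z n"
proof -
  obtain a :: int where a: "n > 0" "Q n" "coprime a (int n)" "c = (of_int a - z) / real n"
    using assms by (auto simp: fracs_def)
  have "coprime (a + s * int n) (int n)"
    using a(3) by (metis coprime_commute coprime_iff_gcd_eq_1 gcd_add_mult add.commute)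
  then show ?thesis using a by (intro fracsI[of _ _ "a + s * int n"]) (auto simp: field_simps)
qed

lemma limsup_nbhd_shift_iff:
  assumes "\<And>n c. c \<in> C n \<Longrightarrow> c + t \<in> C n" "\<And>n c. c \<in> C n \<Longrightarrow> c - t \<in> C n"
  shows "x + t \<in> limsup_nbhd C r \<longleftrightarrow> x \<in> limsup_nbhd C r"
  using limsup_nbhd_affine[of x C r 1 t C] limsup_nbhd_affine[of "x + t" C r 1 "- t" C] assms
  by auto

lemma limsup_nbhd_fracs_shift_int:
  "x + of_int s \<in> limsup_nbhd (fracs Q z) r \<longleftrightarrow> x \<in> limsup_nbhd (fracs Q z) r"
  using fracs_shift_int[of _ Q z _ s] fracs_shift_int[of _ Q z _ "- s"]
  by (intro limsup_nbhd_shift_iff) auto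

lemma limsup_nbhd_fracs_disj:
  "limsup_nbhd (fracs (\<lambda>n. Q n \<or> Q' n) z) r =
    limsup_nbhd (fracs Q z) r \<union> limsup_nbhd (fracs Q' z) r"
proof -
  have "fracs (\<lambda>n. Q n \<or> Q' n) z n = fracs Q z n \<union> fracs Q' z n" for n
    by (auto simp: fracs_def)
  then show ?thesis
    by (auto simp: limsup_nbhd_def bex_Un frequently_disj_iff)
qed

lemma fracs_classes:
  "fracs (\<lambda>_. True) z = fracs (\<lambda>n. \<not> p dvd n \<or> ((p dvd n \<and> \<not> p\<^sup>2 dvd n) \<or> p\<^sup>2 dvd n)) z"
  by (auto simp: fracs_def intro!: ext)

subsection \<open>The zero-one law\<close>

text \<open>The two ways of combining the sets indexed by \<open>m\<close>, \<open>P M \<longleftrightarrow> (\<exists>m\<in>M. m \<ge> 1)\<close> and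
  \<open>P M \<longleftrightarrow> infinite M\<close>, are treated simultaneously.\<close>

locale index_selection =
  fixes P :: "nat set \<Rightarrow> bool"
  assumes mono: "P M \<Longrightarrow> M \<subseteq> M' \<Longrightarrow> P M'"
    and union: "P (M \<union> M') \<Longrightarrow> P M \<or> P M'"
    and dilate: "P M \<Longrightarrow> k > 0 \<Longrightarrow> P ((*) k ` M)"
    and UNIV: "P UNIV"
    and borel: "(\<And>m. S m \<in> sets borel) \<Longrightarrow> {x :: real. P {m. x \<in> S m}} \<in> sets borel"
begin

definition combine :: "(nat \<Rightarrow> real set) \<Rightarrow> real set" where
  "combine S = {x. P {m. x \<in> S m}}"

lemma combine_borel: "(\<And>m. S m \<in> sets borel) \<Longrightarrow> combine S \<in> sets borel"
  unfolding combine_def by (rule borel)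

lemma combine_mono: "(\<And>m. S m \<subseteq> S' m) \<Longrightarrow> combine S \<subseteq> combine S'"
  unfolding combine_def by (auto elim!: mono)

lemma combine_Un: "combine (\<lambda>m. S m \<union> S' m) = combine S \<union> combine S'"
proof
  show "combine (\<lambda>m. S m \<union> S' m) \<subseteq> combine S \<union> combine S'"
  proof
    fix x assume "x \<in> combine (\<lambda>m. S m \<union> S' m)"
    moreover have "{m. x \<in> S m \<union> S' m} = {m. x \<in> S m} \<union> {m. x \<in> S' m}" by auto
    ultimately have "P ({m. x \<in> S m} \<union> {m. x \<in> S' m})" by (simp add: combine_def)
    then show "x \<in> combine S \<union> combine S'" using union by (auto simp: combine_def)
  qed
  show "combine S \<union> combine S' \<subseteq> combine (\<lambda>m. S m \<union> S' m)"
    using combine_mono[of S "\<lambda>m. S m \<union> S' m"] combine_mono[of S' "\<lambda>m. S m \<union> S' m"] by blast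
qed

text \<open>Each application of the map multiplies both the radii and the index \<open>m\<close> by
  \<open>p\<close>. The union over all radii \<open>p ^ k * r n\<close> absorbs the first effect and
  \<open>dilate\<close> the second, so the enlarged set \<open>F\<close> is invariant; by
  \<open>limsup_nbhd_scale\<close> it agrees almost everywhere with the original set.\<close>

lemma combine_expanding_class_null_or_conull:
  fixes p :: nat and y :: real
  assumes r: "r \<longlonglongrightarrow> 0" and p: "p \<ge> 2"
    and inv: "\<And>z n c. c \<in> fracs Q z n \<Longrightarrow> real p * c + b \<in> fracs Q (real p * z) n"
  shows "(AE x in lborel. x \<notin> combine (\<lambda>m. limsup_nbhd (fracs Q (real m * y)) r)) \<or>
         (AE x in lborel. x \<in> combine (\<lambda>m. limsup_nbhd (fracs Q (real m * y)) r))"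
proof -
  define X where "X m k = limsup_nbhd (fracs Q (real m * y)) (\<lambda>n. real p ^ k * r n)" for m k :: nat
  define F where "F = combine (\<lambda>m. \<Union>k. X m k)"
  have X_borel: "X m k \<in> sets borel" for m k by (simp add: X_def)
  have F: "F \<in> sets borel"
    unfolding F_def using X_borel by (intro combine_borel sets.countable_UN) auto
  have per: "x + 1 \<in> F \<longleftrightarrow> x \<in> F" for x
    using limsup_nbhd_fracs_shift_int[of x 1] by (simp add: F_def X_def combine_def)
  have "real p * x + b \<in> F" if "x \<in> F" for x
  proof -
    have "real p * x + b \<in> X (p * m) (Suc k)" if "x \<in> X m k" for m k
      using limsup_nbhd_affine[OF that[unfolded X_def], of "real p" b "fracs Q (real (p * m) * y)"]
        inv[of _ "real m * y"] p
      by (simp add: X_def mult.assoc)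
    then have "(*) p ` {m. x \<in> (\<Union>k. X m k)} \<subseteq> {m. real p * x + b \<in> (\<Union>k. X m k)}" by blast
    moreover have "P ((*) p ` {m. x \<in> (\<Union>k. X m k)})"
      using that p by (intro dilate) (auto simp: F_def combine_def)
    ultimately show ?thesis unfolding F_def combine_def mem_Collect_eq by (rule mono[rotated])
  qed
  then have zo: "(AE x in lborel. x \<notin> F) \<or> (AE x in lborel. x \<in> F)"
    by (intro null_or_conull_if_expanding_invariant[OF F p per])
  have "AE x in lborel. x \<in> X m k \<longrightarrow> x \<in> X m 0" for m k
    using limsup_nbhd_scale[OF r, of "real p ^ k" "fracs Q (real m * y)"] p by (simp add: X_def)
  \<comment> \<open>A single null set serves all \<open>m\<close> and \<open>k\<close>, so off it
    the index sets themselves coincide.\<close>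
  then have "AE x in lborel. \<forall>m k. x \<in> X m k \<longrightarrow> x \<in> X m 0" unfolding AE_all_countable by blast
  then have eq: "AE x in lborel. x \<in> F \<longleftrightarrow> x \<in> combine (\<lambda>m. X m 0)"
  proof eventually_elim
    case (elim x)
    then have "{m. x \<in> (\<Union>k. X m k)} = {m. x \<in> X m 0}" by blast
    then show ?case by (simp only: F_def combine_def mem_Collect_eq)
  qed
  have "(\<lambda>m. X m 0) = (\<lambda>m. limsup_nbhd (fracs Q (real m * y)) r)" by (simp add: X_def)
  moreover have "(AE x in lborel. x \<notin> combine (\<lambda>m. X m 0)) \<or> (AE x in lborel. x \<in> combine (\<lambda>m. X m 0))"
    using zo
  proof
    assume "AE x in lborel. x \<notin> F"
    then have "AE x in lborel. x \<notin> combine (\<lambda>m. X m 0)" using eq by eventually_elim simp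
    then show ?thesis ..
  next
    assume "AE x in lborel. x \<in> F"
    then have "AE x in lborel. x \<in> combine (\<lambda>m. X m 0)" using eq by eventually_elim simp
    then show ?thesis ..
  qed
  ultimately show ?thesis by simp
qed

text \<open>If \<open>E\<close> is not conull, then for each prime \<open>p\<close> neither of its
  parts \<open>A\<close> and \<open>B\<close> is conull. Both are then null, and \<open>E\<close>
  agrees almost everywhere with \<open>D\<close>, which has period \<open>1 / p\<close>. Large
  primes yield arbitrarily short periods.\<close>

lemma combine_limsup_nbhd_null_or_conull:
  fixes y :: real
  assumes r: "r \<longlonglongrightarrow> 0"
  defines "E \<equiv> combine (\<lambda>m. limsup_nbhd (fracs (\<lambda>_. True) (real m * y)) r)"
  shows "(AE x in lborel. x \<notin> E) \<or> (AE x in lborel. x \<in> E)"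
proof (cases "AE x in lborel. x \<in> E")
  case not_full: False
  define X where "X Q = combine (\<lambda>m. limsup_nbhd (fracs Q (real m * y)) r)" for Q
  have E: "E \<in> sets borel" unfolding E_def by (intro combine_borel) simp
  have per: "AE x in lborel. x + 1 / real p \<in> E \<longleftrightarrow> x \<in> E" if p: "prime p" for p
  proof -
    define A where "A = X (\<lambda>n. \<not> p dvd n)"
    define B where "B = X (\<lambda>n. p dvd n \<and> \<not> p\<^sup>2 dvd n)"
    define D where "D = X (\<lambda>n. p\<^sup>2 dvd n)"
    have split: "E = A \<union> (B \<union> D)"
      unfolding E_def A_def B_def D_def X_def fracs_classes[of _ p]
        limsup_nbhd_fracs_disj combine_Un ..
    have "p \<ge> 2" using p by (rule prime_ge_2_nat)
    have "(AE x in lborel. x \<notin> A) \<or> (AE x in lborel. x \<in> A)"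
      unfolding A_def X_def
      by (rule combine_expanding_class_null_or_conull[OF r \<open>p \<ge> 2\<close> fracs_mult_prime[OF p]])
    moreover have "(AE x in lborel. x \<notin> B) \<or> (AE x in lborel. x \<in> B)"
      unfolding B_def X_def
      by (rule combine_expanding_class_null_or_conull[OF r \<open>p \<ge> 2\<close> fracs_mult_prime_shift[OF p]])
    moreover have "\<not> (AE x in lborel. x \<in> A)"
    proof
      assume "AE x in lborel. x \<in> A"
      then have "AE x in lborel. x \<in> E" by eventually_elim (simp add: split)
      then show False using not_full by contradiction
    qed
    moreover have "\<not> (AE x in lborel. x \<in> B)"
    proof
      assume "AE x in lborel. x \<in> B"
      then have "AE x in lborel. x \<in> E" by eventually_elim (simp add: split)
      then show False using not_full by contradiction
    qed
    ultimately have "AE x in lborel. x \<notin> A" "AE x in lborel. x \<notin> B" by auto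
    then have ED: "AE x in lborel. x \<in> E \<longleftrightarrow> x \<in> D" unfolding split by eventually_elim simp
    have D: "x + 1 / real p \<in> D \<longleftrightarrow> x \<in> D" for x
    proof -
      have "x + 1 / real p \<in> limsup_nbhd (fracs (\<lambda>n. p\<^sup>2 dvd n) z) r \<longleftrightarrow>
        x \<in> limsup_nbhd (fracs (\<lambda>n. p\<^sup>2 dvd n) z) r" for z
        using fracs_shift[of p _ z _ 1] fracs_shift[of p _ z _ "- 1"] \<open>p \<ge> 2\<close>
        by (intro limsup_nbhd_shift_iff) auto
      then show ?thesis by (simp add: D_def X_def combine_def)
    qed
    have "D \<in> sets borel" unfolding D_def X_def by (intro combine_borel) simp
    then have "AE x in lborel. 1 / real p + 1 * x \<in> E \<longleftrightarrow> 1 / real p + 1 * x \<in> D"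
      using E by (intro AE_borel_affine[OF _ _ ED]) auto
    then show ?thesis using ED
    proof eventually_elim
      case (elim x)
      then show ?case using D[of x] by (simp add: add.commute)
    qed
  qed
  have "\<exists>N>k. AE x in lborel. x + 1 / real N \<in> E \<longleftrightarrow> x \<in> E" for k
    using per bigger_prime by blast
  then show ?thesis by (intro null_or_conull_if_AE_periodic E)
qed simp

theorem combine_approx_set_null_or_conull:
  assumes \<psi>: "\<And>n. n \<ge> 1 \<Longrightarrow> \<psi> n \<ge> 0"
  shows "combine (\<lambda>m. approx_set \<psi> (real m * y)) \<in> null_sets lebesgue \<or>
         - combine (\<lambda>m. approx_set \<psi> (real m * y)) \<in> null_sets lebesgue"
proof (cases "(\<lambda>n. \<psi> n / real n) \<longlonglongrightarrow> 0")
  case True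
  let ?E = "combine (\<lambda>m. limsup_nbhd (fracs (\<lambda>_. True) (real m * y)) (\<lambda>n. \<psi> n / real n))"
  have E: "?E \<in> sets borel" by (intro combine_borel) simp
  have "?E \<in> null_sets lborel \<or> - ?E \<in> null_sets lborel"
    using combine_limsup_nbhd_null_or_conull[OF True, of y] E
    by (auto simp: AE_iff_null_sets)
  then show ?thesis unfolding approx_set_eq_limsup_nbhd by (auto intro: null_sets_completionI)
next
  case False
  \<comment> \<open>All approximation sets are the whole line, so the index set at every
    \<open>x\<close> is \<open>UNIV\<close>.\<close>
  then show ?thesis using UNIV by (simp add: approx_set_eq_UNIV \<psi> combine_def)
qed

end

theorem theorem1p5:
  fixes y :: real and \<psi> :: "nat \<Rightarrow> real"
  assumes "\<And>n. n \<ge> 1 \<Longrightarrow> \<psi> n \<ge> 0"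
  shows "(approx_union \<psi> y \<in> null_sets lebesgue \<or> - approx_union \<psi> y \<in> null_sets lebesgue) \<and>
         (approx_limsup \<psi> y \<in> null_sets lebesgue \<or> - approx_limsup \<psi> y \<in> null_sets lebesgue)"
proof
  interpret ex: index_selection "\<lambda>M. \<exists>m\<in>M. m \<ge> 1"
  proof
    fix S :: "nat \<Rightarrow> real set" assume "\<And>m. S m \<in> sets borel"
    then have "(\<Union>m\<in>{1..}. S m) \<in> sets borel" by auto
    moreover have "(\<Union>m\<in>{1..}. S m) = {x. \<exists>m\<in>{m. x \<in> S m}. m \<ge> 1}" by auto
    ultimately show "{x. \<exists>m\<in>{m. x \<in> S m}. m \<ge> 1} \<in> sets borel" by simp
  qed auto
  have "approx_union \<psi> y = ex.combine (\<lambda>m. approx_set \<psi> (real m * y))"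
    unfolding ex.combine_def by (auto simp: approx_union_def)
  then show "approx_union \<psi> y \<in> null_sets lebesgue \<or> - approx_union \<psi> y \<in> null_sets lebesgue"
    using ex.combine_approx_set_null_or_conull[OF assms] by simp
  interpret inf: index_selection infinite
  proof
    fix M :: "nat set" and k :: nat assume "infinite M" "k > 0"
    then show "infinite ((*) k ` M)" by (simp add: finite_image_iff inj_on_def)
  next
    fix S :: "nat \<Rightarrow> real set" assume "\<And>m. S m \<in> sets borel"
    then have "(\<Inter>k. \<Union>m\<in>{k..}. S m) \<in> sets borel" by auto
    moreover have "(\<Inter>k. \<Union>m\<in>{k..}. S m) = {x. infinite {m. x \<in> S m}}"
      by (auto simp: infinite_nat_iff_unbounded_le)
    ultimately show "{x. infinite {m. x \<in> S m}} \<in> sets borel" by simp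
  qed (auto intro: finite_subset)
  \<comment> \<open>Only the index 0 can separate the two sets, and one element does not change
    whether a set is infinite.\<close>
  have "infinite {m. m \<ge> 1 \<and> Q m} \<longleftrightarrow> infinite {m. Q m}" for Q :: "nat \<Rightarrow> bool"
  proof -
    have "{m. Q m} \<subseteq> insert 0 {m. m \<ge> 1 \<and> Q m}" by auto
    then show ?thesis by (auto intro: finite_subset)
  qed
  then have "x \<in> approx_limsup \<psi> y \<longleftrightarrow> infinite {m. x \<in> approx_set \<psi> (real m * y)}" for x
    unfolding approx_limsup_iff .
  then have "approx_limsup \<psi> y = inf.combine (\<lambda>m. approx_set \<psi> (real m * y))"
    unfolding inf.combine_def by blast
  then show "approx_limsup \<psi> y \<in> null_sets lebesgue \<or> - approx_limsup \<psi> y \<in> null_sets lebesgue"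
    using inf.combine_approx_set_null_or_conull[OF assms] by simp
qed

end
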